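(* Let $\lVert\cdot\rVert_A$ and $\lVert\cdot\rVert_B$ be rearrangement-invariant quasi-Banach function norms over $([0,\infty),\lambda)$ and let $\lVert\cdot\rVert_{A_i'}$ and $\lVert\cdot\rVert_{B_i'}$ be their respective integrable associate norms. Then there is a constant $C>0$ such that the integrable associate norm $\lVert\cdot\rVert_{(WL(A,B))_i'}$ of $\lVert\cdot\rVert_{WL(A,B)}$ satisfies $$\lVert f\rVert_{(WL(A,B))_i'}\le\lVert f\rVert_{WL(A_i',B_i')}\le C\lVert f\rVert_{(WL(A,B))_i'}$$ for every $f\in M$. Consequently, the integrable associate space satisfies $(WL(A,B))_i'=WL(A_i',B_i')$, up to equivalence of the defining functionals.
   Context: $\lambda$ is Lebesgue measure on $[0,\infty)$; $M$ is the set of extended complex-valued $\lambda$-measurable functions on $[0,\infty)$ (identified when equal a.e.), $M_+$ the non-negative ones. The non-increasing rearrangement of $f\in M$ is $f^*(t)=\inf\{s\ge 0:\lambda(\{|f|>s\})\le t\}$. A quasi-Banach function norm is a map $\lVert\cdot\rVert:M\to[0,\infty]$ with $\lVert\,|f|\,\rVert=\lVert f\rVert$ whose restriction to $M_+$ satisfies: (Q1) it is positively homogeneous, $\lVert f\rVert=0\Leftrightarrow f=0$ a.e., and there is a constant $C\ge1$ with $\lVert f+g\rVert\le C(\lVert f\rVert+\lVert g\rVert)$; (P2) $f\le g$ a.e. implies $\lVert f\rVert\le\lVert g\rVert$; (P3) $f_n\uparrow f$ a.e. implies $\lVert f_n\rVert\uparrow\lVert f\rVert$; (P4) $\lVert\chi_E\rVert<\infty$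 whenever $\lambda(E)<\infty$. It is rearrangement-invariant (r.i.) if $f^*=g^*$ implies $\lVert f\rVert=\lVert g\rVert$. The corresponding space is $X=\{f\in M:\lVert f\rVert_X<\infty\}$. For r.i. quasi-Banach function norms: $\lVert f\rVert_{WL(A,B)}=\lVert f^*\chi_{[0,1]}\rVert_A+\lVert f^*\chi_{(1,\infty)}\rVert_B$ for $f\in M$, and $WL(A,B)=\{f\in M:\lVert f\rVert_{WL(A,B)}<\infty\}$; this is again an r.i. quasi-Banach function norm. For an r.i. quasi-Banach function norm $\lVert\cdot\rVert_X$, the integrable norm is $\lVert f\rVert_{X_i}=\max\{\lVert f\rVert_X,\lVert f\rVert_{WL(L^1,L^\infty)}\}$, with $X_i=\{f\in M:\lVert f\rVert_{X_i}<\infty\}$. The integrable associate norm of $\lVert\cdot\rVert_X$ is the associate functional of $\lVert\cdot\rVert_{X_i}$: $\lVert f\rVert_{X_i'}=\sup_{g\in X_i}\frac1{\lVert g\rVert_{X_i}}\int_0^\infty|fg|\,d\lambda$ (with $\frac00=0$), and the integrable associate space is $X_i'=\{f\in M:\lVert f\rVert_{X_i'}<\infty\}$. (The integrable associate norm is always an r.i. Banach function norm.) *)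

theory Defs
  imports "HOL-Probability.Essential_Supremum"
begin

text \<open>
  The extended complex numbers are the one-point compactification of the plane, with
  \<^term>\<open>None\<close> as the point at infinity, equipped with the Borel sets of that topology.
\<close>

type_synonym ecomplex = "complex option"

definition ecomplex_borel :: "ecomplex measure" where
  "ecomplex_borel = sigma UNIV {U. openin (Alexandroff_compactification euclidean) U}"

definition emod :: "ecomplex \<Rightarrow> ennreal" where
  "emod z = (case z of None \<Rightarrow> \<infinity> | Some w \<Rightarrow> ennreal (cmod w))"

definition ecomplex_of_ennreal :: "ennreal \<Rightarrow> ecomplex" where
  "ecomplex_of_ennreal r = (if r = \<infinity> then None else Some (complex_of_real (enn2real r)))"

text \<open>
  Functions live on all of \<^typ>\<open>real\<close>; only their values on \<open>[0,\<infinity>)\<close> are relevant.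
  There is no quotient by almost everywhere equality: invariance under the modulus together with
  monotonicity with respect to \<open>f \<le> g\<close> a.e. forces a norm to respect it.
\<close>

definition lam :: "real measure" where
  "lam = lebesgue_on {0..}"

definition Mfun :: "(real \<Rightarrow> ecomplex) set" where
  "Mfun = lam \<rightarrow>\<^sub>M ecomplex_borel"

text \<open>The non-negative functions are those valued in \<^typ>\<open>ennreal\<close>, embedded as follows.\<close>

definition Mplus :: "(real \<Rightarrow> ennreal) set" where
  "Mplus = borel_measurable lam"

definition embed :: "(real \<Rightarrow> ennreal) \<Rightarrow> real \<Rightarrow> ecomplex" where
  "embed f = (\<lambda>x. ecomplex_of_ennreal (f x))"

definition modulus :: "(real \<Rightarrow> ecomplex) \<Rightarrow> real \<Rightarrow> ennreal" where
  "modulus f = (\<lambda>x. emod (f x))"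

definition rearrangement :: "(real \<Rightarrow> ecomplex) \<Rightarrow> real \<Rightarrow> ennreal" where
  "rearrangement f t =
     (INF s\<in>{s::real. 0 \<le> s \<and> emeasure lam {x\<in>space lam. modulus f x > ennreal s} \<le> ennreal t}.
        ennreal s)"

type_synonym functional = "(real \<Rightarrow> ecomplex) \<Rightarrow> ennreal"

definition quasi_banach_function_norm :: "functional \<Rightarrow> bool" where
  "quasi_banach_function_norm N \<longleftrightarrow>
     (\<forall>f\<in>Mfun. N (embed (modulus f)) = N f) \<and>
     (\<forall>a::real. \<forall>f\<in>Mplus. 0 \<le> a \<longrightarrow>
        N (embed (\<lambda>x. ennreal a * f x)) = ennreal a * N (embed f)) \<and>
     (\<forall>f\<in>Mplus. N (embed f) = 0 \<longleftrightarrow> (AE x in lam. f x = 0)) \<and>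
     (\<exists>C::real. 1 \<le> C \<and> (\<forall>f\<in>Mplus. \<forall>g\<in>Mplus.
        N (embed (\<lambda>x. f x + g x)) \<le> ennreal C * (N (embed f) + N (embed g)))) \<and>
     (\<forall>f\<in>Mplus. \<forall>g\<in>Mplus. (AE x in lam. f x \<le> g x) \<longrightarrow> N (embed f) \<le> N (embed g)) \<and>
     (\<forall>F f. (\<forall>n::nat. F n \<in> Mplus) \<and> f \<in> Mplus \<and>
        (AE x in lam. incseq (\<lambda>n. F n x) \<and> (\<lambda>n. F n x) \<longlonglongrightarrow> f x) \<longrightarrow>
        incseq (\<lambda>n. N (embed (F n))) \<and> (\<lambda>n. N (embed (F n))) \<longlonglongrightarrow> N (embed f)) \<and>
     (\<forall>E\<in>sets lam. emeasure lam E < \<infinity> \<longrightarrow> N (embed (indicator E)) < \<infinity>)"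

definition ri_quasi_banach_function_norm :: "functional \<Rightarrow> bool" where
  "ri_quasi_banach_function_norm N \<longleftrightarrow>
     quasi_banach_function_norm N \<and>
     (\<forall>f\<in>Mfun. \<forall>g\<in>Mfun. (\<forall>t\<ge>0. rearrangement f t = rearrangement g t) \<longrightarrow> N f = N g)"

definition fspace :: "functional \<Rightarrow> (real \<Rightarrow> ecomplex) set" where
  "fspace N = {f\<in>Mfun. N f < \<infinity>}"

definition L1_norm :: functional where
  "L1_norm f = (\<integral>\<^sup>+x. modulus f x \<partial>lam)"

definition Linf_norm :: functional where
  "Linf_norm f = esssup lam (modulus f)"

definition WL :: "functional \<Rightarrow> functional \<Rightarrow> functional" where
  "WL A B f = A (embed (\<lambda>t. rearrangement f t * indicator {0..1} t))
            + B (embed (\<lambda>t. rearrangement f t * indicator {1<..} t))"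

definition integrable_norm :: "functional \<Rightarrow> functional" where
  "integrable_norm N f = max (N f) (WL L1_norm Linf_norm f)"

text \<open>
  In \<^typ>\<open>ennreal\<close>, \<open>0 / 0 = 0 * \<infinity> = 0\<close>, which is the convention required here, and
  \<open>\<bar>f g\<bar> = \<bar>f\<bar> \<bar>g\<bar>\<close> is formed with \<open>0 * \<infinity> = 0\<close>.
\<close>

definition associate :: "functional \<Rightarrow> functional" where
  "associate N f = (SUP g\<in>fspace N. (\<integral>\<^sup>+x. modulus f x * modulus g x \<partial>lam) / N g)"

definition integrable_associate :: "functional \<Rightarrow> functional" where
  "integrable_associate N = associate (integrable_norm N)"

end

theory Submission
  imports Defs
begin

text \<open>
  By Hardy--Littlewood, \<open>\<integral> |f g| \<le> \<integral> f* g*\<close>; splitting the right-hand side at \<open>1\<close> and applying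
  Hoelder's inequality for \<open>A\<close> and \<open>B\<close> separately gives the first estimate. For the second, testing
  against \<open>g\<close> may be replaced by testing \<open>f*\<close> against decreasing functions \<open>h\<close>, and
  \<open>\<integral> f* h\<close> is at most the product of the associate norm of \<open>f\<close> and the norm of \<open>h\<close>, because
  \<open>f\<close> can be paired with a function on the half-line that is aligned with \<open>f\<close> and no larger than
  \<open>h\<close> in distribution. For the \<open>A\<close> part one takes \<open>h = g* \<chi>[0,1]\<close>. For the \<open>B\<close> part
  one takes \<open>h = min (g*) (g*(1))\<close>, the remaining piece on \<open>[0,1]\<close> being bounded by
  \<open>f*(1) \<integral>\<^sub>0\<^sup>1 g*\<close>; membership of \<open>g\<close> in \<open>L\<^sup>1 + L\<^sup>\<infinity>\<close> controls \<open>g*(1)\<close> and that integral.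
\<close>

section \<open>Lebesgue measure on the half-line\<close>

lemma space_lam: "space lam = {0..}"
  by (simp add: lam_def)

lemma sets_lam_borel:
  assumes "S \<in> sets borel" "S \<subseteq> {0..}"
  shows "S \<in> sets lam"
  using assms by (auto simp: lam_def sets_restrict_space_iff)

lemma emeasure_lam_borel:
  assumes "S \<in> sets borel" "S \<subseteq> {0..}"
  shows "emeasure lam S = emeasure lborel S"
  using assms by (simp add: lam_def emeasure_restrict_space emeasure_completion)

lemma emeasure_lam_interval:
  assumes "0 \<le> a" "a \<le> b"
  shows "emeasure lam {a..b} = ennreal (b - a)"
  using assms by (subst emeasure_lam_borel) auto

lemma measurable_lam_borel:
  assumes "f \<in> borel_measurable borel"
  shows "f \<in> borel_measurable lam"
  unfolding lam_def using assms
  by (intro measurable_restrict_space1 measurable_completion) simp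

lemma indicator_measurable_lam [measurable]:
  fixes S :: "real set"
  shows "S \<in> sets borel \<Longrightarrow> (indicator S :: real \<Rightarrow> ennreal) \<in> borel_measurable lam"
  by (rule measurable_lam_borel) simp

lemma sigma_finite_lam: "sigma_finite_measure lam"
proof
  let ?A = "range (\<lambda>n::nat. {0..real n})"
  have "\<Union>?A = {0..}" by (auto simp: real_arch_simple)
  then show "\<exists>A. countable A \<and> A \<subseteq> sets lam \<and> \<Union>A = space lam \<and> (\<forall>a\<in>A. emeasure lam a \<noteq> \<infinity>)"
    by (intro exI[of _ ?A]) (auto simp: space_lam emeasure_lam_interval intro!: sets_lam_borel)
qed

interpretation lam_lborel: pair_sigma_finite lam lborel
  by (simp add: pair_sigma_finite_def sigma_finite_lam lborel.sigma_finite_measure_axioms)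

lemma less_ennreal_borel: "{t::real. 0 \<le> t \<and> ennreal t < v} \<in> sets borel"
  by measurable

text \<open>The set is the interval [0,v), written so that v = \<infinity> is covered as well.
  Superlevel sets of a decreasing rearrangement have exactly this shape, and so do the sets in the
  layer-cake formula.\<close>

lemma emeasure_lborel_less: "emeasure lborel {t::real. 0 \<le> t \<and> ennreal t < v} = v"
proof (cases v)
  case (real r)
  then have "{t::real. 0 \<le> t \<and> ennreal t < v} = {0..<r}"
    by (auto simp: ennreal_less_iff)
  then show ?thesis using real by simp
next
  case top
  then have "{t::real. 0 \<le> t \<and> ennreal t < v} = {0..}" by auto
  moreover have "emeasure lborel {0::real..} = \<infinity>"
  proof (cases "emeasure lborel {0::real..}")
    case (real r)
    have "emeasure lborel {0..r + 1} \<le> emeasure lborel {0::real..}"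
      by (rule emeasure_mono) auto
    with real show ?thesis by simp
  qed simp
  ultimately show ?thesis using top by simp
qed

lemma emeasure_lam_less: "emeasure lam {t. 0 \<le> t \<and> ennreal t < v} = v"
  by (subst emeasure_lam_borel) (auto simp: emeasure_lborel_less less_ennreal_borel)

section \<open>Distribution function and decreasing rearrangement\<close>

definition distribution :: "(real \<Rightarrow> ennreal) \<Rightarrow> real \<Rightarrow> ennreal" where
  "distribution u s = emeasure lam {x\<in>space lam. ennreal s < u x}"

text \<open>\<open>rearrangement\<close> depends on a function only through its modulus, so the
  measure theory can be done for \<open>ennreal\<close>-valued functions, free of
  \<open>embed\<close>.\<close>

definition decr :: "(real \<Rightarrow> ennreal) \<Rightarrow> real \<Rightarrow> ennreal" where
  "decr u t = (INF s\<in>{s::real. 0 \<le> s \<and> distribution u s \<le> ennreal t}. ennreal s)"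

lemma rearrangement_eq_decr: "rearrangement f = decr (modulus f)"
  by (simp add: fun_eq_iff rearrangement_def decr_def distribution_def)

lemma sets_superlevel [measurable]:
  fixes u :: "real \<Rightarrow> ennreal"
  assumes "u \<in> borel_measurable lam"
  shows "{x\<in>space lam. c < u x} \<in> sets lam"
  using assms by measurable

lemma distribution_mono:
  assumes [measurable]: "v \<in> borel_measurable lam" and "AE x in lam. u x \<le> v x"
  shows "distribution u s \<le> distribution v s"
  unfolding distribution_def using assms(2)
  by (intro emeasure_mono_AE) (auto elim: eventually_mono)

lemma distribution_antimono:
  assumes [measurable]: "u \<in> borel_measurable lam" and "s \<le> s'"
  shows "distribution u s' \<le> distribution u s"
  unfolding distribution_def
  by (rule emeasure_mono) (auto intro: order.strict_trans1 ennreal_leI[OF assms(2)])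

text \<open>The distribution function is right-continuous, so the infimum defining
  \<open>decr\<close>, when finite, is attained. This makes \<open>decr u\<close> the generalized
  inverse of \<open>distribution u\<close> with strict inequalities on both sides, and every later
  fact about superlevel sets of \<open>decr u\<close> rests on it.\<close>

lemma less_decr_iff:
  assumes u [measurable]: "u \<in> borel_measurable lam" and "0 \<le> s"
  shows "ennreal s < decr u t \<longleftrightarrow> ennreal t < distribution u s"
proof
  assume "ennreal s < decr u t"
  then show "ennreal t < distribution u s"
    using \<open>0 \<le> s\<close> unfolding decr_def
    by (metis (mono_tags, lifting) INF_lower linorder_not_less mem_Collect_eq)
next
  assume *: "ennreal t < distribution u s"
  show "ennreal s < decr u t"
  proof (rule ccontr)
    assume "\<not> ennreal s < decr u t"
    then have le: "decr u t \<le> ennreal s" by simp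
    have small: "distribution u s' \<le> ennreal t" if "s < s'" for s'
    proof -
      have "decr u t < ennreal s'"
        using le that \<open>0 \<le> s\<close> by (meson ennreal_lessI order.strict_trans1 order.strict_trans2 order_le_less_trans)
      then obtain r where "0 \<le> r" "distribution u r \<le> ennreal t" "ennreal r < ennreal s'"
        unfolding decr_def INF_less_iff by auto
      then show ?thesis
        using distribution_antimono[OF u, of r s'] by (auto simp: ennreal_less_iff)
    qed
    \<comment> \<open>Right-continuity at \<open>s\<close>: the superlevel set is the increasing
      union of those at heights s + 1/(k+1), each of measure at most t by
      \<open>small\<close>.\<close>
    let ?E = "\<lambda>k::nat. {x\<in>space lam. ennreal (s + 1 / real (Suc k)) < u x}"
    have "{x\<in>space lam. ennreal s < u x} = (\<Union>k. ?E k)"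
    proof (intro set_eqI iffI)
      fix x assume x: "x \<in> {x\<in>space lam. ennreal s < u x}"
      then obtain r where r: "ennreal s < r" "r < u x" using dense by blast
      then obtain r' where r': "r = ennreal r'" "0 \<le> r'" by (cases r) auto
      with r \<open>0 \<le> s\<close> have "0 < r' - s" by (simp add: ennreal_less_iff)
      then obtain k where "1 / real (Suc k) < r' - s"
        using nat_approx_posE by blast
      then have "ennreal (s + 1 / real (Suc k)) \<le> r" using r' by (auto intro: ennreal_leI)
      with r x show "x \<in> (\<Union>k. ?E k)" by (auto intro: order.strict_trans1)
    next
      fix x assume "x \<in> (\<Union>k. ?E k)"
      then show "x \<in> {x\<in>space lam. ennreal s < u x}"
        by (auto elim!: order.strict_trans1[rotated] intro!: ennreal_leI)
    qed
    then have "distribution u s = emeasure lam (\<Union>k. ?E k)"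
      by (simp add: distribution_def)
    also have "\<dots> = (SUP k. emeasure lam (?E k))"
    proof (rule SUP_emeasure_incseq[symmetric])
      show "incseq ?E"
        by (auto simp: incseq_def elim!: order.strict_trans1[rotated] intro!: ennreal_leI
            divide_left_mono)
    qed auto
    also have "\<dots> \<le> ennreal t"
      using small by (auto simp: distribution_def intro!: SUP_least)
    finally show False using * by simp
  qed
qed

lemma decr_le_iff:
  assumes "u \<in> borel_measurable lam" and "0 \<le> s"
  shows "decr u t \<le> ennreal s \<longleftrightarrow> distribution u s \<le> ennreal t"
  using less_decr_iff[OF assms] by (simp add: not_less[symmetric])

lemma superlevel_decr:
  assumes "u \<in> borel_measurable lam" "0 \<le> s"
  shows "{t\<in>space lam. ennreal s < decr u t} = {t. 0 \<le> t \<and> ennreal t < distribution u s}"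
  using less_decr_iff[OF assms] by (auto simp: space_lam)

lemma decr_measurable [measurable]:
  assumes "u \<in> borel_measurable lam"
  shows "decr u \<in> borel_measurable lam"
proof (rule borel_measurableI_greater)
  fix y
  show "{t\<in>space lam. y < decr u t} \<in> sets lam"
  proof (cases y)
    case (real r)
    then show ?thesis
      using superlevel_decr[OF assms, of r] less_ennreal_borel by (auto intro!: sets_lam_borel)
  qed auto
qed

lemma distribution_decr:
  assumes "u \<in> borel_measurable lam" "0 \<le> s"
  shows "distribution (decr u) s = distribution u s"
  unfolding distribution_def[of "decr u"] superlevel_decr[OF assms] by (rule emeasure_lam_less)

lemma decr_mono_distribution:
  assumes "\<And>s. 0 \<le> s \<Longrightarrow> distribution u s \<le> distribution v s"
  shows "decr u t \<le> decr v t"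
  unfolding decr_def
  by (rule INF_superset_mono) (auto intro: order_trans[OF assms])

lemma decr_mono:
  assumes "v \<in> borel_measurable lam" "AE x in lam. u x \<le> v x"
  shows "decr u t \<le> decr v t"
  by (intro decr_mono_distribution distribution_mono assms)

lemma decr_decr:
  assumes "u \<in> borel_measurable lam"
  shows "decr (decr u) = decr u"
  using assms by (intro ext antisym decr_mono_distribution) (auto simp: distribution_decr)

lemma decr_antimono:
  assumes "t \<le> t'"
  shows "decr u t' \<le> decr u t"
  unfolding decr_def
  by (rule INF_superset_mono) (auto intro: order_trans ennreal_leI[OF assms])

lemma decr_eq_0_of_support:
  assumes "\<And>x. x \<in> space lam - S \<Longrightarrow> u x = 0" "S \<in> sets lam" "emeasure lam S \<le> ennreal t"
  shows "decr u t = 0"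
proof -
  have "distribution u 0 \<le> emeasure lam S"
    unfolding distribution_def using assms by (intro emeasure_mono) force+
  then have "decr u t \<le> ennreal 0"
    unfolding decr_def using assms(3) by (intro INF_lower) auto
  then show ?thesis by simp
qed

lemma decr_le_const:
  assumes "\<And>x. 0 \<le> x \<Longrightarrow> u x \<le> c"
  shows "decr u t \<le> c"
proof (cases c)
  case (real r)
  then have "{x\<in>space lam. ennreal r < u x} = {}"
    using assms by (auto simp: not_less space_lam)
  then have "distribution u r = 0" unfolding distribution_def by (simp only: emeasure_empty)
  then show ?thesis
    unfolding decr_def using real by (auto intro!: INF_lower)
qed auto

text \<open>\<open>decr u\<close> is positive exactly on [0,d), where d is the measure of the set on
  which u > 0. Vanishing a.e. on [0,1] therefore forces min d 1 = 0, that is, d = 0.\<close>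

lemma AE_eq_0_of_decr:
  assumes u [measurable]: "u \<in> borel_measurable lam" and "AE t in lam. t \<in> {0..1} \<longrightarrow> decr u t = 0"
  shows "AE x in lam. u x = 0"
proof -
  let ?d = "distribution u 0"
  have "{t. 0 \<le> t \<and> ennreal t < min ?d 1} \<in> sets lam"
    by (intro sets_lam_borel less_ennreal_borel) auto
  moreover have "AE t in lam. t \<notin> {t. 0 \<le> t \<and> ennreal t < min ?d 1}"
    using assms(2)
  proof eventually_elim
    case (elim t)
    then show ?case using less_decr_iff[OF u, of 0 t] by (auto simp: ennreal_le_1)
  qed
  ultimately have "emeasure lam {t. 0 \<le> t \<and> ennreal t < min ?d 1} = 0"
    using AE_iff_null_sets by blast
  then have "min ?d 1 = 0" by (simp only: emeasure_lam_less)
  then have "?d = 0" by (metis min_def zero_neq_one)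
  then have "{x\<in>space lam. 0 < u x} \<in> null_sets lam"
    using sets_superlevel[OF u, of 0] by (auto simp: distribution_def)
  then show ?thesis
    by (rule AE_I') (auto simp: zero_less_iff_neq_zero)
qed

section \<open>Layer-cake formula and the Hardy-Littlewood inequality\<close>

text \<open>Write u(x) as the length of [0,u(x)) and apply Tonelli. The guard
  \<open>0 \<le> s\<close> discards negative heights, which \<open>ennreal\<close> would collapse to
  0.\<close>

lemma nn_integral_mult_layer:
  assumes [measurable]: "u \<in> borel_measurable lam" "w \<in> borel_measurable lam"
  shows "(\<integral>\<^sup>+x. u x * w x \<partial>lam)
    = (\<integral>\<^sup>+s. (if 0 \<le> s then \<integral>\<^sup>+x. (if ennreal s < u x then w x else 0) \<partial>lam else 0) \<partial>lborel)"
proof -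
  have "u x * w x = (\<integral>\<^sup>+s. (if 0 \<le> s \<and> ennreal s < u x then w x else 0) \<partial>lborel)" for x
  proof -
    have "(\<integral>\<^sup>+s. (if 0 \<le> s \<and> ennreal s < u x then w x else 0) \<partial>lborel)
        = (\<integral>\<^sup>+s. w x * indicator {s. 0 \<le> s \<and> ennreal s < u x} s \<partial>lborel)"
      by (intro nn_integral_cong) (auto simp: indicator_def)
    also have "\<dots> = w x * u x"
      by (subst nn_integral_cmult_indicator) (auto simp: emeasure_lborel_less)
    finally show ?thesis by (simp add: mult.commute)
  qed
  then have "(\<integral>\<^sup>+x. u x * w x \<partial>lam)
      = (\<integral>\<^sup>+x. (\<integral>\<^sup>+s. (if 0 \<le> s \<and> ennreal s < u x then w x else 0) \<partial>lborel) \<partial>lam)"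
    by simp
  also have "\<dots> = (\<integral>\<^sup>+s. (\<integral>\<^sup>+x. (if 0 \<le> s \<and> ennreal s < u x then w x else 0) \<partial>lam) \<partial>lborel)"
    by (rule lam_lborel.Fubini'[symmetric]) measurable
  also have "\<dots> = (\<integral>\<^sup>+s. (if 0 \<le> s then \<integral>\<^sup>+x. (if ennreal s < u x then w x else 0) \<partial>lam else 0) \<partial>lborel)"
    by (intro nn_integral_cong) auto
  finally show ?thesis .
qed

text \<open>Using the layer-cake formula for both factors turns the integral of a product into a
  double integral, over heights s and t, of the measure of the joint superlevel set. It serves both
  Hardy-Littlewood and its converse.\<close>

lemma nn_integral_mult_mono_superlevel:
  assumes [measurable]: "u \<in> borel_measurable lam" "v \<in> borel_measurable lam"
      "u' \<in> borel_measurable lam" "v' \<in> borel_measurable lam"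
    and le: "\<And>s t. 0 \<le> s \<Longrightarrow> 0 \<le> t \<Longrightarrow>
      emeasure lam {x\<in>space lam. ennreal s < u x \<and> ennreal t < v x}
        \<le> emeasure lam {x\<in>space lam. ennreal s < u' x \<and> ennreal t < v' x}"
  shows "(\<integral>\<^sup>+x. u x * v x \<partial>lam) \<le> (\<integral>\<^sup>+x. u' x * v' x \<partial>lam)"
proof -
  have eq: "(\<integral>\<^sup>+x. (if ennreal s < a x then b x else 0) \<partial>lam)
      = (\<integral>\<^sup>+t. (if 0 \<le> t then emeasure lam {x\<in>space lam. ennreal s < a x \<and> ennreal t < b x} else 0) \<partial>lborel)"
    if [measurable]: "a \<in> borel_measurable lam" "b \<in> borel_measurable lam" for a b s
  proof -
    have "(\<integral>\<^sup>+x. (if ennreal s < a x then b x else 0) \<partial>lam)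
        = (\<integral>\<^sup>+x. b x * (if ennreal s < a x then 1 else 0) \<partial>lam)"
      by (intro nn_integral_cong) auto
    also have "\<dots> = (\<integral>\<^sup>+t. (if 0 \<le> t then \<integral>\<^sup>+x. (if ennreal t < b x then if ennreal s < a x then 1 else 0 else 0) \<partial>lam else 0) \<partial>lborel)"
      by (rule nn_integral_mult_layer) measurable
    finally have layer: "(\<integral>\<^sup>+x. (if ennreal s < a x then b x else 0) \<partial>lam) = \<dots>" .
    have inner: "(\<integral>\<^sup>+x. (if ennreal t < b x then if ennreal s < a x then 1 else 0 else 0) \<partial>lam)
        = emeasure lam {x\<in>space lam. ennreal s < a x \<and> ennreal t < b x}" for t
    proof -
      have "(\<integral>\<^sup>+x. (if ennreal t < b x then if ennreal s < a x then 1 else 0 else 0) \<partial>lam)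
          = (\<integral>\<^sup>+x. indicator {x\<in>space lam. ennreal s < a x \<and> ennreal t < b x} x \<partial>lam)"
        by (intro nn_integral_cong) auto
      then show ?thesis by simp
    qed
    show ?thesis unfolding layer inner ..
  qed
  show ?thesis
    by (subst (1 2) nn_integral_mult_layer)
       (auto simp: eq intro!: nn_integral_mono le)
qed

text \<open>Superlevel sets of rearrangements are initial intervals, hence nested, so their
  intersection is the smaller one. For arbitrary functions the minimum is only an upper bound, which
  is what Hardy-Littlewood exploits.\<close>

lemma emeasure_superlevel_decr_inter:
  assumes "u \<in> borel_measurable lam" "v \<in> borel_measurable lam" "0 \<le> s" "0 \<le> t"
  shows "emeasure lam {x\<in>space lam. ennreal s < decr u x \<and> ennreal t < decr v x}
    = min (distribution u s) (distribution v t)"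
proof -
  have "{x\<in>space lam. ennreal s < decr u x \<and> ennreal t < decr v x}
      = {x. 0 \<le> x \<and> ennreal x < min (distribution u s) (distribution v t)}"
    using assms by (auto simp: less_decr_iff space_lam)
  then show ?thesis by (simp only: emeasure_lam_less)
qed

lemma hardy_littlewood:
  assumes [measurable]: "u \<in> borel_measurable lam" "v \<in> borel_measurable lam"
  shows "(\<integral>\<^sup>+x. u x * v x \<partial>lam) \<le> (\<integral>\<^sup>+t. decr u t * decr v t \<partial>lam)"
proof (rule nn_integral_mult_mono_superlevel)
  fix s t :: real assume "0 \<le> s" "0 \<le> t"
  then show "emeasure lam {x\<in>space lam. ennreal s < u x \<and> ennreal t < v x}
      \<le> emeasure lam {x\<in>space lam. ennreal s < decr u x \<and> ennreal t < decr v x}"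
    by (subst emeasure_superlevel_decr_inter)
       (auto simp: distribution_def intro!: emeasure_mono)
qed measurable

section \<open>Initial segments of prescribed measure\<close>

text \<open>
  Initial segments of \<open>{0..n}\<close> for the order by decreasing \<open>u\<close>, with ties broken by position, so
  that every measure up to \<open>n\<close> is attained.
\<close>

definition lexlevel :: "(real \<Rightarrow> ennreal) \<Rightarrow> real \<Rightarrow> ennreal \<Rightarrow> real \<Rightarrow> real set" where
  "lexlevel u n a c = {x\<in>space lam. x \<le> n \<and> (a < u x \<or> u x = a \<and> x \<le> c)}"

lemma sets_lexlevel [measurable]:
  assumes [measurable]: "u \<in> borel_measurable lam"
  shows "lexlevel u n a c \<in> sets lam"
proof -
  have [measurable]: "(\<lambda>x. x) \<in> borel_measurable lam" by (rule measurable_lam_borel) simp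
  show ?thesis unfolding lexlevel_def by measurable
qed

lemma emeasure_lexlevel_le:
  assumes "u \<in> borel_measurable lam" "0 \<le> n"
  shows "emeasure lam (lexlevel u n a c) \<le> ennreal n"
proof -
  have "emeasure lam (lexlevel u n a c) \<le> emeasure lam {0..n}"
    by (rule emeasure_mono) (auto simp: lexlevel_def space_lam intro!: sets_lam_borel)
  then show ?thesis using assms by (simp add: emeasure_lam_interval)
qed

text \<open>At the right height the strict superlevel set is too small or exact and the weak one too
  large or exact. Moving the cut-off \<open>c\<close> through the plateau interpolates continuously
  between them, so the intermediate value theorem applies.\<close>

lemma ex_lexlevel_emeasure:
  assumes u [measurable]: "u \<in> borel_measurable lam" and q: "0 \<le> q" "q \<le> n"
  shows "\<exists>a c. emeasure lam (lexlevel u n a c) = ennreal q"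
proof -
  \<comment> \<open>Cutting off at n gives the superlevel sets finite measure, as continuity from
    above requires.\<close>
  define v where "v x = u x * indicator {0..n} x" for x
  have v [measurable]: "v \<in> borel_measurable lam"
    unfolding v_def by measurable
  have [measurable]: "(\<lambda>x. x) \<in> borel_measurable lam" by (rule measurable_lam_borel) simp
  have "0 \<le> n" using q by simp
  define a where "a = decr v q"
  define \<phi> where "\<phi> c = measure lam (lexlevel u n a c)" for c
  have fin: "emeasure lam (lexlevel u n b c) < \<infinity>" for b c
    using emeasure_lexlevel_le[OF u \<open>0 \<le> n\<close>, of b c] by (auto intro: order.strict_trans1)
  have \<phi>: "emeasure lam (lexlevel u n a c) = ennreal (\<phi> c)" for c
    unfolding \<phi>_def using fin by (intro emeasure_eq_ennreal_measure) (auto simp: less_top)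
  have v_less: "{x\<in>space lam. b < v x} = {x\<in>space lam. x \<le> n \<and> b < u x}" for b
    by (auto simp: v_def indicator_def space_lam)
  \<comment> \<open>The space has no negative points, so the cut-off -1 admits no ties and leaves
    the strict superlevel set.\<close>
  have "lexlevel u n a (-1) = {x\<in>space lam. a < v x}"
    unfolding v_less by (auto simp: lexlevel_def space_lam)
  moreover have "emeasure lam {x\<in>space lam. a < v x} \<le> ennreal q"
  proof (cases a)
    case (real r)
    then show ?thesis
      using decr_le_iff[OF v, of r q] by (simp add: a_def distribution_def)
  qed simp
  ultimately have lo: "\<phi> (-1) \<le> q"
    using q \<phi>[of "-1"] by simp
  have hi: "q \<le> \<phi> n"
  \<comment> \<open>At height 0 there are no heights strictly below to approximate from, but the
    weak superlevel set is then all of [0,n].\<close>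
  proof (cases "a = 0")
    case True
    then have "lexlevel u n a n = {0..n}"
      by (auto simp: lexlevel_def space_lam zero_less_iff_neq_zero)
    then have "ennreal (\<phi> n) = ennreal n"
      using \<phi>[of n] \<open>0 \<le> n\<close> by (simp add: emeasure_lam_interval)
    then show ?thesis using q by (simp add: \<phi>_def)
  next
    case False
    then have "0 \<in> {..<a}" by (simp add: zero_less_iff_neq_zero)
    then have "{..<a} \<noteq> {}" by blast
    from ennreal_Sup_countable_SUP[OF this] obtain f
      where f: "incseq f" "range f \<subseteq> {..<a}" and Sup: "Sup {..<a} = (SUP i. f i)" by blast
    have Sup: "(SUP i. f i) = a"
      unfolding Sup[symmetric] by (rule Sup_lessThan)
    let ?E = "\<lambda>i. {x\<in>space lam. f i < v x}"
    \<comment> \<open>The weak superlevel set is the decreasing limit of strict ones at heights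
      increasing to \<open>a\<close>, each of measure at least q since its height lies below
      \<open>decr v q\<close>.\<close>
    have "lexlevel u n a n = (\<Inter>i. ?E i)"
    proof (intro set_eqI iffI)
      fix x assume "x \<in> lexlevel u n a n"
      then show "x \<in> (\<Inter>i. ?E i)"
        unfolding v_less using f(2) by (auto simp: lexlevel_def intro: order.strict_trans)
    next
      fix x assume x: "x \<in> (\<Inter>i. ?E i)"
      then have "x \<in> space lam" "x \<le> n" "\<And>i. f i < u x"
        unfolding v_less by auto
      moreover from this have "a \<le> u x"
        unfolding Sup[symmetric] by (intro SUP_least less_imp_le)
      ultimately show "x \<in> lexlevel u n a n"
        by (auto simp: lexlevel_def le_less)
    qed
    moreover have "emeasure lam (\<Inter>i. ?E i) = (INF i. emeasure lam (?E i))"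
    proof (rule INF_emeasure_decseq[symmetric])
      show "decseq ?E"
        using f(1) by (auto simp: decseq_def incseq_def intro: order.strict_trans1)
      show "emeasure lam (?E i) \<noteq> \<infinity>" for i
      proof -
        have "emeasure lam (?E i) \<le> emeasure lam {0..n}"
          unfolding v_less by (rule emeasure_mono) (auto simp: space_lam intro!: sets_lam_borel)
        then show ?thesis using \<open>0 \<le> n\<close> by (auto simp: emeasure_lam_interval top_unique)
      qed
    qed auto
    moreover have "ennreal q \<le> emeasure lam (?E i)" for i
    proof -
      have "f i < a" using f(2) by auto
      then obtain r where r: "f i = ennreal r" "0 \<le> r"
        by (cases "f i") auto
      with \<open>f i < a\<close> show ?thesis
        using less_decr_iff[OF v, of r q] by (simp add: a_def distribution_def)
    qed
    ultimately have "ennreal q \<le> ennreal (\<phi> n)"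
      unfolding \<phi>[symmetric] by (auto intro!: INF_greatest)
    then show ?thesis by (simp add: \<phi>_def)
  qed
  \<comment> \<open>Raising the cut-off from c to d adds only points between c and d. The maxima
    with 0 account for cut-offs left of the half-line.\<close>
  have lip: "\<bar>\<phi> d - \<phi> c\<bar> \<le> d - c" if "c \<le> d" for c d
  proof -
    have "emeasure lam (lexlevel u n a c) \<le> emeasure lam (lexlevel u n a d)"
      using that by (intro emeasure_mono) (auto simp: lexlevel_def)
    moreover have "emeasure lam (lexlevel u n a d)
        \<le> emeasure lam (lexlevel u n a c \<union> {max 0 c..max 0 d})"
      by (intro emeasure_mono sets.Un sets_lam_borel sets_lexlevel u)
         (auto simp: lexlevel_def space_lam)
    moreover have "\<dots> \<le> emeasure lam (lexlevel u n a c) + emeasure lam {max 0 c..max 0 d}"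
      by (intro emeasure_subadditive sets_lam_borel sets_lexlevel u) auto
    ultimately have "ennreal (\<phi> c) \<le> ennreal (\<phi> d)"
        and "ennreal (\<phi> d) \<le> ennreal (\<phi> c) + ennreal (max 0 d - max 0 c)"
      using that unfolding \<phi> by (simp_all add: emeasure_lam_interval)
    moreover have "0 \<le> \<phi> c" "0 \<le> \<phi> d" by (simp_all add: \<phi>_def)
    ultimately show ?thesis
      using that by (simp flip: ennreal_plus split: if_splits)
  qed
  have "1-lipschitz_on UNIV \<phi>"
  proof (rule lipschitz_onI)
    fix c d
    show "dist (\<phi> c) (\<phi> d) \<le> 1 * dist c d"
      using lip[of c d] lip[of d c] by (cases "c \<le> d") (auto simp: dist_real_def)
  qed simp
  then have "continuous_on {-1..n} \<phi>"
    using continuous_on_subset lipschitz_on_continuous_on by blast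
  then obtain c where "\<phi> c = q"
    using IVT'[of \<phi> "-1" q n] lo hi \<open>0 \<le> n\<close> by auto
  then show ?thesis using \<phi>[of c] by auto
qed

lemma lexlevel_mono:
  assumes "b < a \<or> a = b \<and> c \<le> d"
  shows "lexlevel u n a c \<subseteq> lexlevel u n b d"
  unfolding lexlevel_def using assms by (blast intro: order.strict_trans order.trans)

text \<open>The segments form a chain, indexed lexicographically by height and cut-off, so a strict
  inequality between measures becomes an inclusion.\<close>

lemma lexlevel_comparable:
  "lexlevel u n a c \<subseteq> lexlevel u n b d \<or> lexlevel u n b d \<subseteq> lexlevel u n a c"
  using lexlevel_mono[of b a c d u n] lexlevel_mono[of a b d c u n]
  by (meson linear linorder_less_linear)

lemma lexlevel_superlevel_comparable:
  "lexlevel u n a c \<subseteq> {x\<in>space lam. x \<le> n \<and> b < u x}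
    \<or> {x\<in>space lam. x \<le> n \<and> b < u x} \<subseteq> lexlevel u n a c"
proof (cases "a \<le> b")
  case True
  then have "{x\<in>space lam. x \<le> n \<and> b < u x} \<subseteq> lexlevel u n a c"
    unfolding lexlevel_def by (blast intro: order.strict_trans1)
  then show ?thesis ..
next
  case False
  then have "b < a" by simp
  then have "lexlevel u n a c \<subseteq> {x\<in>space lam. x \<le> n \<and> b < u x}"
    unfolding lexlevel_def by (blast intro: order.strict_trans)
  then show ?thesis ..
qed

section \<open>A converse to Hardy-Littlewood\<close>

text \<open>The rearrangement of \<open>k\<close> is transported along a chain of segments E q of
  measure q ordered by decreasing u, so that superlevel sets of \<open>h\<close> and of the
  truncated \<open>u\<close> are nested. The distribution of \<open>h\<close> may be smaller than
  that of \<open>k\<close>, because \<open>h\<close> lives on [0,n].\<close>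

lemma ex_equimeasurable_aligned:
  assumes u [measurable]: "u \<in> borel_measurable lam" and k [measurable]: "k \<in> borel_measurable lam"
    and "0 \<le> n"
  shows "\<exists>h\<in>borel_measurable lam. (\<forall>s\<ge>0. distribution h s \<le> distribution k s) \<and>
    (\<integral>\<^sup>+t. decr (\<lambda>x. u x * indicator {0..n} x) t * decr k t \<partial>lam) \<le> (\<integral>\<^sup>+x. u x * h x \<partial>lam)"
proof -
  define v where "v x = u x * indicator {0..n} x" for x
  have v [measurable]: "v \<in> borel_measurable lam"
    unfolding v_def by measurable
  have v_less: "{x\<in>space lam. b < v x} = {x\<in>space lam. x \<le> n \<and> b < u x}" for b
    by (auto simp: v_def indicator_def space_lam)
  have "\<exists>a. \<forall>q\<in>{0..n}. \<exists>c. emeasure lam (lexlevel u n (a q) c) = ennreal q"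
    using ex_lexlevel_emeasure[OF u, of _ n] by (intro bchoice) auto
  then obtain a where "\<forall>q\<in>{0..n}. \<exists>c. emeasure lam (lexlevel u n (a q) c) = ennreal q" ..
  from bchoice[OF this] obtain c
    where "\<forall>q\<in>{0..n}. emeasure lam (lexlevel u n (a q) (c q)) = ennreal q" ..
  then have ac: "emeasure lam (lexlevel u n (a q) (c q)) = ennreal q" if "q \<in> {0..n}" for q
    using that by (rule bspec)
  define E where "E q = lexlevel u n (a q) (c q)" for q
  have E [measurable]: "E q \<in> sets lam" for q by (simp add: E_def)
  have emE: "emeasure lam (E q) = ennreal q" if "q \<in> {0..n}" for q
    using ac[OF that] by (simp add: E_def)
  have E_mono: "E q \<subseteq> E r" if "q \<in> {0..n}" "r \<in> {0..n}" "q < r" for q r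
  proof -
    have "\<not> E r \<subseteq> E q"
    proof
      assume "E r \<subseteq> E q"
      then have "emeasure lam (E r) \<le> emeasure lam (E q)" by (rule emeasure_mono) simp
      with that show False by (simp add: emE)
    qed
    then show ?thesis using lexlevel_comparable unfolding E_def by blast
  qed
  have E_sub: "E q \<subseteq> {x\<in>space lam. b < v x}"
    if "q \<in> {0..n}" "ennreal q < emeasure lam {x\<in>space lam. b < v x}" for q b
  proof -
    have "\<not> {x\<in>space lam. b < v x} \<subseteq> E q"
    proof
      assume "{x\<in>space lam. b < v x} \<subseteq> E q"
      then have "emeasure lam {x\<in>space lam. b < v x} \<le> emeasure lam (E q)" by (rule emeasure_mono) simp
      with that show False by (simp add: emE)
    qed
    then show ?thesis using lexlevel_superlevel_comparable unfolding E_def v_less by blast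
  qed
  \<comment> \<open>Rational indices keep the supremum countable, hence \<open>h\<close> measurable,
    and are dense enough for the strict comparison of measures below.\<close>
  define Q where "Q = \<rat> \<inter> {0..n}"
  have "countable Q" unfolding Q_def by (simp add: countable_rat)
  define h where "h x = (SUP q\<in>Q. decr k q * indicator (E q) x)" for x
  have h [measurable]: "h \<in> borel_measurable lam"
    unfolding h_def using \<open>countable Q\<close> by measurable
  have h_less: "b < h x \<longleftrightarrow> (\<exists>q\<in>Q. b < decr k q \<and> x \<in> E q)" for b x
    unfolding h_def less_SUP_iff by (auto simp: indicator_def)
  have dist_h: "distribution h s \<le> distribution k s" if "0 \<le> s" for s
  proof -
    have sub: "\<exists>q\<in>Q. ennreal q < distribution k s \<and> x \<in> E q" if "ennreal s < h x" for x
      using that less_decr_iff[OF k \<open>0 \<le> s\<close>] unfolding h_less by blast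
    show ?thesis
    \<comment> \<open>Either the superlevel set of \<open>h\<close> lies in the segment of measure
      \<open>distribution k s\<close>, or that measure exceeds n and the support of \<open>h\<close>
      already gives the bound.\<close>
    proof (cases "distribution k s \<le> ennreal n")
      case True
      then obtain r where r: "distribution k s = ennreal r" "r \<in> {0..n}"
        using \<open>0 \<le> n\<close> by (cases "distribution k s") (auto simp: top_unique)
      have "{x\<in>space lam. ennreal s < h x} \<subseteq> E r"
      proof
        fix x assume "x \<in> {x\<in>space lam. ennreal s < h x}"
        then obtain q where "q \<in> Q" "ennreal q < ennreal r" "x \<in> E q" using sub r by auto
        then show "x \<in> E r" using E_mono[of q r] r by (auto simp: Q_def ennreal_less_iff)
      qed
      then have "distribution h s \<le> emeasure lam (E r)"
        unfolding distribution_def by (rule emeasure_mono) simp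
      then show ?thesis using r by (simp add: emE)
    next
      case False
      have "{x\<in>space lam. ennreal s < h x} \<subseteq> {0..n}"
        using sub by (fastforce simp: E_def lexlevel_def space_lam)
      then have "distribution h s \<le> emeasure lam {0..n}"
        unfolding distribution_def by (rule emeasure_mono) (auto intro!: sets_lam_borel)
      then show ?thesis using False \<open>0 \<le> n\<close> by (simp add: emeasure_lam_interval)
    qed
  qed
  have "(\<integral>\<^sup>+t. decr v t * decr k t \<partial>lam) \<le> (\<integral>\<^sup>+x. v x * h x \<partial>lam)"
  proof (rule nn_integral_mult_mono_superlevel)
    fix s t :: real assume st: "0 \<le> s" "0 \<le> t"
    let ?m = "min (distribution v s) (distribution k t)"
    let ?S = "{x\<in>space lam. ennreal s < v x \<and> ennreal t < h x}"
    have "?m \<le> emeasure lam ?S"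
    proof (rule ccontr)
      assume "\<not> ?m \<le> emeasure lam ?S"
      then have "emeasure lam ?S < ?m" by (simp only: not_le)
      moreover have "distribution v s \<le> emeasure lam {0..n}"
        unfolding distribution_def v_less
        by (rule emeasure_mono) (auto simp: space_lam intro!: sets_lam_borel)
      then have mn: "?m \<le> ennreal n"
        using \<open>0 \<le> n\<close> by (auto simp: emeasure_lam_interval min_le_iff_disj)
      ultimately obtain l m where lm: "emeasure lam ?S = ennreal l" "?m = ennreal m" "0 \<le> l" "l < m" "m \<le> n"
        using \<open>0 \<le> n\<close> by (cases "emeasure lam ?S"; cases ?m) (auto simp: top_unique ennreal_less_iff)
      \<comment> \<open>A segment whose measure lies strictly between the two sides is contained in
        both superlevel sets, hence in ?S, which is too small to hold it.\<close>
      obtain q where q: "q \<in> \<rat>" "l < q" "q < m" using Rats_dense_in_real lm by blast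
      then have "q \<in> Q" using lm by (auto simp: Q_def)
      have "ennreal q < ?m" unfolding lm(2) using q lm by (simp add: ennreal_less_iff)
      then have less: "ennreal q < distribution v s" "ennreal q < distribution k t" by auto
      then have "E q \<subseteq> {x\<in>space lam. ennreal s < v x}"
        using \<open>q \<in> Q\<close> by (intro E_sub) (auto simp: Q_def distribution_def)
      moreover have "ennreal t < decr k q" using less_decr_iff[OF k st(2)] less by simp
      then have "\<And>x. x \<in> E q \<Longrightarrow> ennreal t < h x" using \<open>q \<in> Q\<close> h_less by blast
      ultimately have "E q \<subseteq> ?S" by auto
      then have "emeasure lam (E q) \<le> emeasure lam ?S" by (rule emeasure_mono) measurable
      then show False using \<open>q \<in> Q\<close> q lm by (simp add: emE Q_def)
    qed
    then show "emeasure lam {x\<in>space lam. ennreal s < decr v x \<and> ennreal t < decr k x} \<le> emeasure lam ?S"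
      using st by (simp only: emeasure_superlevel_decr_inter v k)
  qed measurable
  also have "\<dots> \<le> (\<integral>\<^sup>+x. u x * h x \<partial>lam)"
    by (intro nn_integral_mono) (auto simp: v_def indicator_def)
  finally show ?thesis using h dist_h unfolding v_def[abs_def] by blast
qed

text \<open>Continuity of measure from below, read through \<open>less_decr_iff\<close>. It removes
  the truncation imposed by the aligned construction.\<close>

lemma decr_truncate_SUP:
  assumes u [measurable]: "u \<in> borel_measurable lam"
  shows "decr u t = (SUP n. decr (\<lambda>x. u x * indicator {0..real n} x) t)"
proof (rule antisym)
  let ?v = "\<lambda>n x. u x * indicator {0..real n} x"
  have v [measurable]: "?v n \<in> borel_measurable lam" for n
    by measurable
  show "(SUP n. decr (?v n) t) \<le> decr u t"
    by (intro SUP_least decr_mono u) (auto simp: indicator_def)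
  show "decr u t \<le> (SUP n. decr (?v n) t)"
  proof (rule dense_le)
    fix y assume y: "y < decr u t"
    then obtain s where s: "y = ennreal s" "0 \<le> s" by (cases y) auto
    have "{x\<in>space lam. ennreal s < u x} = (\<Union>n. {x\<in>space lam. ennreal s < ?v n x})"
    proof (intro set_eqI iffI)
      fix x assume x: "x \<in> {x\<in>space lam. ennreal s < u x}"
      obtain n :: nat where "x \<le> real n" using real_arch_simple by blast
      with x have "x \<in> {x\<in>space lam. ennreal s < ?v n x}" by (auto simp: space_lam)
      then show "x \<in> (\<Union>n. {x\<in>space lam. ennreal s < ?v n x})" by blast
    qed (auto simp: indicator_def of_bool_def split: if_splits)
    then have "distribution u s = emeasure lam (\<Union>n. {x\<in>space lam. ennreal s < ?v n x})"
      by (simp only: distribution_def)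
    also have "\<dots> = (SUP n. distribution (?v n) s)"
      unfolding distribution_def
    proof (rule SUP_emeasure_incseq[symmetric])
      show "incseq (\<lambda>n. {x\<in>space lam. ennreal s < ?v n x})"
        by (auto simp: incseq_def indicator_def split: if_splits)
    qed auto
    finally have "ennreal t < (SUP n. distribution (?v n) s)"
      using y less_decr_iff[OF u s(2), of t] s(1) by simp
    then obtain n where "ennreal t < distribution (?v n) s" by (auto simp: less_SUP_iff)
    then have "y < decr (?v n) t" using less_decr_iff[OF v s(2)] s(1) by simp
    also have "\<dots> \<le> (SUP n. decr (?v n) t)" by (rule SUP_upper) simp
    finally show "y \<le> (SUP n. decr (?v n) t)" by simp
  qed
qed

section \<open>Measurability on the extended complex plane\<close>

text \<open>For finite y the superlevel set is the complement of a compact disc together with the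
  point at infinity, hence open in the compactification.\<close>

lemma emod_measurable: "emod \<in> borel_measurable ecomplex_borel"
proof (rule borel_measurableI_greater)
  fix y
  have sp: "space ecomplex_borel = UNIV" by (simp add: ecomplex_borel_def)
  have "{z. y < emod z} \<in> sets ecomplex_borel"
  proof (cases y)
    case (real r)
    have "z \<in> {z. y < emod z} \<longleftrightarrow> z \<in> insert None (Some ` (topspace euclidean - cball 0 r))" for z
      using real by (cases z) (auto simp: emod_def ennreal_less_iff)
    then have "{z. y < emod z} = insert None (Some ` (topspace euclidean - cball 0 r))" by blast
    moreover have "openin (Alexandroff_compactification euclidean) (insert None (Some ` (topspace euclidean - cball (0::complex) r)))"
      unfolding openin_Alexandroff_compactification
      by (intro disjI2 exI[of _ "cball 0 r"]) auto
    ultimately show ?thesis by (auto simp: ecomplex_borel_def)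
  qed simp
  then show "{z\<in>space ecomplex_borel. y < emod z} \<in> sets ecomplex_borel" by (simp add: sp)
qed

lemma ecomplex_of_ennreal_measurable: "ecomplex_of_ennreal \<in> borel \<rightarrow>\<^sub>M ecomplex_borel"
  unfolding ecomplex_borel_def
proof (rule measurable_measure_of)
  have "(\<lambda>x. complex_of_real (enn2real x)) \<in> borel_measurable borel" by measurable
  then have preimage: "(\<lambda>x. complex_of_real (enn2real x)) -` V \<in> sets borel" if "open V" for V
    using that by (intro measurable_sets_borel[of _ borel]) auto
  fix U :: "ecomplex set" assume "U \<in> {U. openin (Alexandroff_compactification euclidean) U}"
  then consider V where "open V" "U = Some ` V" | K where "compact K" "U = insert None (Some ` (- K))"
    unfolding openin_Alexandroff_compactification mem_Collect_eq Compl_eq_Diff_UNIV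
    by (metis compactin_euclidean_iff open_openin topspace_euclidean)
  then have "{x. ecomplex_of_ennreal x \<in> U} \<in> sets borel"
  proof cases
    case 1
    then have "{x. ecomplex_of_ennreal x \<in> U} = (\<lambda>x. complex_of_real (enn2real x)) -` V - {\<infinity>}"
      by (auto simp: ecomplex_of_ennreal_def)
    then show ?thesis using preimage[OF 1(1)] by simp
  next
    case 2
    then have "open (- K)" using compact_imp_closed by blast
    moreover have "{x. ecomplex_of_ennreal x \<in> U} = insert \<infinity> ((\<lambda>x. complex_of_real (enn2real x)) -` (- K))"
      using 2 by (auto simp: ecomplex_of_ennreal_def)
    ultimately show ?thesis using preimage[of "- K"] by simp
  qed
  then show "ecomplex_of_ennreal -` U \<inter> space borel \<in> sets borel" by (simp add: vimage_def)
qed auto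

lemma modulus_embed [simp]: "modulus (embed u) = u"
  by (simp add: fun_eq_iff modulus_def embed_def emod_def ecomplex_of_ennreal_def
      ennreal_enn2real_if)

lemma modulus_measurable: "f \<in> Mfun \<Longrightarrow> modulus f \<in> borel_measurable lam"
  unfolding Mfun_def modulus_def using emod_measurable by (rule measurable_compose[rotated])

lemma embed_in_Mfun: "u \<in> borel_measurable lam \<Longrightarrow> embed u \<in> Mfun"
  unfolding Mfun_def embed_def using ecomplex_of_ennreal_measurable by (rule measurable_compose[rotated])

section \<open>Associate functionals and Hoelder inequalities\<close>

text \<open>Replaces the quotient by a product. If N g = 0 the hypothesis makes the integral 0, even
  for c = \<infinity>, and the convention 0/0 = 0 applies.\<close>

lemma associate_le:
  assumes "\<And>g. g \<in> Mfun \<Longrightarrow> N g < \<infinity> \<Longrightarrow> (\<integral>\<^sup>+x. modulus f x * modulus g x \<partial>lam) \<le> c * N g"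
  shows "associate N f \<le> c"
  unfolding associate_def
proof (rule SUP_least)
  fix g assume "g \<in> fspace N"
  then have g: "g \<in> Mfun" "N g < \<infinity>" by (auto simp: fspace_def)
  note * = assms[OF this]
  show "(\<integral>\<^sup>+x. modulus f x * modulus g x \<partial>lam) / N g \<le> c"
  proof (cases "N g = 0")
    case False
    have "(\<integral>\<^sup>+x. modulus f x * modulus g x \<partial>lam) / N g \<le> c * N g / N g"
      using * by (rule divide_right_mono_ennreal)
    also have "\<dots> = c" using False g by (intro mult_divide_eq_ennreal) auto
    finally show ?thesis .
  qed (use * in simp)
qed

definition definite :: "functional \<Rightarrow> bool" where
  "definite N \<longleftrightarrow> (\<forall>f\<in>Mfun. N f = 0 \<longrightarrow> (AE x in lam. modulus f x = 0))"

lemma associate_hoelder: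
  assumes "definite N" "g \<in> Mfun" "N g < \<infinity>"
  shows "(\<integral>\<^sup>+x. modulus f x * modulus g x \<partial>lam) \<le> associate N f * N g"
proof (cases "N g = 0")
  case True
  then have "AE x in lam. modulus g x = 0" using assms by (auto simp: definite_def)
  then have "(\<integral>\<^sup>+x. modulus f x * modulus g x \<partial>lam) = (\<integral>\<^sup>+x. 0 \<partial>lam)"
    by (intro nn_integral_cong_AE) auto
  then show ?thesis by simp
next
  case False
  have "(\<integral>\<^sup>+x. modulus f x * modulus g x \<partial>lam) / N g \<le> associate N f"
    unfolding associate_def using assms by (intro SUP_upper) (auto simp: fspace_def)
  then have "N g * ((\<integral>\<^sup>+x. modulus f x * modulus g x \<partial>lam) / N g) \<le> N g * associate N f"
    by (rule mult_left_mono) simp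
  moreover have "N g * (I / N g) = I" for I
    using False assms(3) by (simp add: ennreal_times_divide mult.commute[of "N g"] mult_divide_eq_ennreal)
  ultimately show ?thesis by (simp add: mult.commute)
qed

text \<open>Stronger than rearrangement invariance, because the aligned function is only dominated
  in distribution by the one it replaces.\<close>

definition rearrangement_mono :: "functional \<Rightarrow> bool" where
  "rearrangement_mono N \<longleftrightarrow>
     (\<forall>f\<in>Mfun. \<forall>g\<in>Mfun. (\<forall>t\<ge>0. rearrangement f t \<le> rearrangement g t) \<longrightarrow> N f \<le> N g)"

text \<open>The associate functional pairs with f, while the integral contains f*. The aligned
  function h carries the pairing of the rearrangements back to one of f with h, and h* \<le> g*
  gives N h \<le> N g.\<close>

lemma associate_hoelder_decr:
  assumes N: "definite N" "rearrangement_mono N" and f: "f \<in> Mfun" and g: "g \<in> Mfun" "N g < \<infinity>"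
  shows "(\<integral>\<^sup>+x. decr (modulus f) x * modulus g x \<partial>lam) \<le> associate N f * N g"
proof -
  let ?u = "modulus f" and ?k = "modulus g"
  let ?v = "\<lambda>n x. ?u x * indicator {0..real n} x"
  note [measurable] = modulus_measurable[OF f] modulus_measurable[OF g(1)]
  have v [measurable]: "?v n \<in> borel_measurable lam" for n
    by measurable
  have bound: "(\<integral>\<^sup>+t. decr (?v n) t * decr ?k t \<partial>lam) \<le> associate N f * N g" for n
  proof -
    obtain h where h: "h \<in> borel_measurable lam" "\<forall>s\<ge>0. distribution h s \<le> distribution ?k s"
      and le: "(\<integral>\<^sup>+t. decr (?v n) t * decr ?k t \<partial>lam) \<le> (\<integral>\<^sup>+x. ?u x * h x \<partial>lam)"
      using ex_equimeasurable_aligned[of ?u ?k "real n"] by auto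
    have "decr h t \<le> decr ?k t" for t using h(2) by (intro decr_mono_distribution) auto
    then have Nh: "N (embed h) \<le> N g"
      using N(2) h(1) g(1) by (auto simp: rearrangement_mono_def rearrangement_eq_decr embed_in_Mfun)
    note le
    also have "(\<integral>\<^sup>+x. ?u x * h x \<partial>lam) \<le> associate N f * N (embed h)"
      using associate_hoelder[OF N(1) embed_in_Mfun[OF h(1)], of f] Nh g(2) by simp
    also have "\<dots> \<le> associate N f * N g" using Nh by (rule mult_left_mono) simp
    finally show ?thesis .
  qed
  \<comment> \<open>Hardy-Littlewood for f* and g, where f* is its own rearrangement.\<close>
  have "(\<integral>\<^sup>+x. decr ?u x * ?k x \<partial>lam) \<le> (\<integral>\<^sup>+x. decr ?u x * decr ?k x \<partial>lam)"
    using hardy_littlewood[of "decr ?u" ?k] by (simp add: decr_decr)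
  also have "\<dots> = (\<integral>\<^sup>+x. (SUP n. decr (?v n) x * decr ?k x) \<partial>lam)"
    by (subst decr_truncate_SUP) (auto simp: SUP_mult_right_ennreal)
  also have "\<dots> = (SUP n. \<integral>\<^sup>+x. decr (?v n) x * decr ?k x \<partial>lam)"
  proof (rule nn_integral_monotone_convergence_SUP)
    show "incseq (\<lambda>n x. decr (?v n) x * decr ?k x)"
      by (intro incseq_SucI le_funI mult_right_mono decr_mono v) (auto simp: indicator_def)
  qed measurable
  also have "\<dots> \<le> associate N f * N g" by (intro SUP_least bound)
  finally show ?thesis .
qed

section \<open>Monotonicity and definiteness of the functionals\<close>

lemma mult_indicator_le: "(a::ennreal) * indicator S x \<le> a"
  by (auto split: split_indicator)

text \<open>A property shared by the given norms and by \<open>L1_norm\<close> and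
  \<open>Linf_norm\<close>, so that \<open>WL A B\<close> and \<open>WL L1_norm Linf_norm\<close>
  are handled by the same lemma.\<close>

definition lattice_mono :: "functional \<Rightarrow> bool" where
  "lattice_mono N \<longleftrightarrow>
     (\<forall>u\<in>borel_measurable lam. \<forall>v\<in>borel_measurable lam. (\<forall>x\<ge>0. u x \<le> v x) \<longrightarrow> N (embed u) \<le> N (embed v))"

lemma lattice_monoD:
  assumes "lattice_mono N" "u \<in> borel_measurable lam" "v \<in> borel_measurable lam" "\<And>x. 0 \<le> x \<Longrightarrow> u x \<le> v x"
  shows "N (embed u) \<le> N (embed v)"
  using assms by (auto simp: lattice_mono_def)

lemma rearrangement_monoD:
  assumes "rearrangement_mono N" "f \<in> Mfun" "g \<in> Mfun"
    "\<And>t. 0 \<le> t \<Longrightarrow> decr (modulus f) t \<le> decr (modulus g) t"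
  shows "N f \<le> N g"
  using assms by (auto simp: rearrangement_mono_def rearrangement_eq_decr)

lemma lattice_mono_L1: "lattice_mono L1_norm"
  by (auto simp: lattice_mono_def L1_norm_def space_lam intro!: nn_integral_mono)

lemma lattice_mono_Linf: "lattice_mono Linf_norm"
  by (auto simp: lattice_mono_def Linf_norm_def space_lam intro!: esssup_AE_mono AE_I2)

lemma rearrangement_mono_WL:
  assumes "lattice_mono A" "lattice_mono B"
  shows "rearrangement_mono (WL A B)"
  unfolding rearrangement_mono_def
proof (intro ballI impI)
  fix f g assume fg: "f \<in> Mfun" "g \<in> Mfun" and le: "\<forall>t\<ge>0. rearrangement f t \<le> rearrangement g t"
  note [measurable] = fg[THEN modulus_measurable]
  show "WL A B f \<le> WL A B g"
    unfolding WL_def rearrangement_eq_decr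
    using le unfolding rearrangement_eq_decr
    by (intro add_mono lattice_monoD assms) (auto intro!: mult_right_mono)
qed

lemma rearrangement_mono_integrable_norm:
  assumes "rearrangement_mono N"
  shows "rearrangement_mono (integrable_norm N)"
  using assms rearrangement_mono_WL[OF lattice_mono_L1 lattice_mono_Linf]
  unfolding rearrangement_mono_def integrable_norm_def by (meson max.mono)

lemma nn_integral_decr_le_WL:
  assumes "g \<in> Mfun"
  shows "(\<integral>\<^sup>+t. decr (modulus g) t * indicator {0..1} t \<partial>lam) \<le> WL L1_norm Linf_norm g"
  by (simp add: WL_def L1_norm_def rearrangement_eq_decr)

text \<open>The L1 component controls f* on [0,1], and that already decides whether f vanishes
  a.e.\<close>

lemma definite_integrable_norm: "definite (integrable_norm N)"
  unfolding definite_def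
proof (intro ballI impI)
  fix f assume f: "f \<in> Mfun" and "integrable_norm N f = 0"
  note [measurable] = modulus_measurable[OF f]
  have "WL L1_norm Linf_norm f \<le> integrable_norm N f" by (simp add: integrable_norm_def)
  with nn_integral_decr_le_WL[OF f] \<open>integrable_norm N f = 0\<close>
  have "(\<integral>\<^sup>+t. decr (modulus f) t * indicator {0..1} t \<partial>lam) = 0" by simp
  then have "AE t in lam. decr (modulus f) t * indicator {0..1} t = 0"
    by (subst (asm) nn_integral_0_iff_AE) auto
  then have "AE t in lam. t \<in> {0..1} \<longrightarrow> decr (modulus f) t = 0"
    by eventually_elim auto
  then show "AE x in lam. modulus f x = 0"
    by (rule AE_eq_0_of_decr[OF modulus_measurable[OF f]])
qed

section \<open>Consequences of the axioms of an r.i. quasi-norm\<close>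

context
  fixes N :: functional
  assumes N: "ri_quasi_banach_function_norm N"
begin

lemma qbf: "quasi_banach_function_norm N"
  using N unfolding ri_quasi_banach_function_norm_def by (rule conjunct1)

lemma norm_AE_mono:
  assumes "u \<in> borel_measurable lam" "v \<in> borel_measurable lam" "AE x in lam. u x \<le> v x"
  shows "N (embed u) \<le> N (embed v)"
  using qbf assms by (simp add: quasi_banach_function_norm_def Mplus_def)

lemma lattice_mono_norm: "lattice_mono N"
  unfolding lattice_mono_def
  by (intro ballI impI norm_AE_mono) (auto simp: space_lam)

lemma norm_decr:
  assumes "f \<in> Mfun"
  shows "N (embed (decr (modulus f))) = N f"
proof -
  note u = modulus_measurable[OF assms]
  have "rearrangement (embed (decr (modulus f))) = rearrangement f"
    by (simp add: rearrangement_eq_decr decr_decr u)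
  then have eq: "\<forall>t\<ge>0. rearrangement (embed (decr (modulus f))) t = rearrangement f t"
    by simp
  have "\<forall>f\<in>Mfun. \<forall>g\<in>Mfun. (\<forall>t\<ge>0. rearrangement f t = rearrangement g t) \<longrightarrow> N f = N g"
    using N unfolding ri_quasi_banach_function_norm_def by (rule conjunct2)
  from this[THEN bspec, THEN bspec, THEN mp, OF embed_in_Mfun[OF decr_measurable[OF u]] assms eq]
  show ?thesis .
qed

lemma norm_zero: "N (embed (\<lambda>x. 0)) = 0"
  using qbf by (simp add: quasi_banach_function_norm_def Mplus_def)

lemma norm_scale:
  assumes "u \<in> borel_measurable lam" "c < \<infinity>"
  shows "N (embed (\<lambda>x. c * u x)) = c * N (embed u)"
proof -
  obtain r where "c = ennreal r" "0 \<le> r" using assms(2) by (cases c) auto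
  then show ?thesis
    using qbf assms(1) by (simp add: quasi_banach_function_norm_def Mplus_def)
qed

lemma norm_unit_interval: "N (embed (indicator {0..1})) < \<infinity>"
proof -
  have "{0..1::real} \<in> sets lam" "emeasure lam {0..1} < \<infinity>"
    by (auto simp: emeasure_lam_interval intro!: sets_lam_borel)
  then show ?thesis
    using qbf by (simp add: quasi_banach_function_norm_def)
qed

end

section \<open>Amalgam norms of functions supported in the unit interval\<close>

lemma WL_embed:
  "WL A B (embed u) = A (embed (\<lambda>t. decr u t * indicator {0..1} t)) + B (embed (\<lambda>t. decr u t * indicator {1<..} t))"
  by (simp add: WL_def rearrangement_eq_decr)

text \<open>A function living on [0,1] has its rearrangement supported there too, so the
  \<open>B\<close> component vanishes.\<close>

lemma WL_le_of_support:
  assumes A: "ri_quasi_banach_function_norm A" and B: "ri_quasi_banach_function_norm B"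
    and k [measurable]: "k \<in> borel_measurable lam" and supp: "\<And>x. 1 < x \<Longrightarrow> k x = 0"
  shows "WL A B (embed k) \<le> A (embed k)"
proof -
  have zero: "decr k t = 0" if "1 < t" for t
    by (rule decr_eq_0_of_support[of "{0..1}"])
       (use that supp in \<open>auto simp: space_lam emeasure_lam_interval not_le intro!: sets_lam_borel\<close>)
  have "(\<lambda>t. decr k t * indicator {1<..} t) = (\<lambda>t. 0)"
    using zero by (auto simp: fun_eq_iff split: split_indicator)
  then have "WL A B (embed k) = A (embed (\<lambda>t. decr k t * indicator {0..1} t))"
    by (simp add: WL_embed norm_zero[OF B])
  also have "\<dots> \<le> A (embed (decr k))"
    by (intro lattice_monoD lattice_mono_norm A mult_indicator_le) measurable
  also have "\<dots> = A (embed k)"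
    using norm_decr[OF A embed_in_Mfun[OF k]] by simp
  finally show ?thesis .
qed

lemma WL_L1_Linf_unit_interval: "WL L1_norm Linf_norm (embed (indicator {0..1})) \<le> 1"
proof -
  let ?k = "indicator {0..1} :: real \<Rightarrow> ennreal"
  have zero: "decr ?k t = 0" if "1 < t" for t
    by (rule decr_eq_0_of_support[of "{0..1}"])
       (use that in \<open>auto simp: space_lam emeasure_lam_interval not_le intro!: sets_lam_borel\<close>)
  have "(\<lambda>t. decr ?k t * indicator {1<..} t) = (\<lambda>t. 0)"
    using zero by (auto simp: fun_eq_iff split: split_indicator)
  then have "WL L1_norm Linf_norm (embed ?k) = (\<integral>\<^sup>+t. decr ?k t * indicator {0..1} t \<partial>lam) + esssup lam (\<lambda>t. 0)"
    by (simp add: WL_embed L1_norm_def Linf_norm_def)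
  also have "esssup lam (\<lambda>t. 0 :: ennreal) \<le> 0" by (rule esssup_I) auto
  also have "(\<integral>\<^sup>+t. decr ?k t * indicator {0..1} t \<partial>lam) \<le> (\<integral>\<^sup>+t. indicator {0..1} t \<partial>lam)"
    by (intro nn_integral_mono) (auto simp: indicator_def intro!: decr_le_const)
  also have "\<dots> = 1"
    by (subst nn_integral_indicator) (auto simp: emeasure_lam_interval intro!: sets_lam_borel)
  finally show ?thesis by simp
qed

section \<open>The two estimates between the associate norms\<close>

context
  fixes A B :: functional
  assumes A: "ri_quasi_banach_function_norm A" and B: "ri_quasi_banach_function_norm B"
begin

private abbreviation "W \<equiv> WL L1_norm Linf_norm"
private abbreviation "Ai \<equiv> integrable_norm A"
private abbreviation "Bi \<equiv> integrable_norm B"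
private abbreviation "Xi \<equiv> integrable_norm (WL A B)"

lemma mono_Xi: "rearrangement_mono Xi"
  by (intro rearrangement_mono_integrable_norm rearrangement_mono_WL lattice_mono_norm A B)

lemma W_mono_decr:
  assumes "u \<in> borel_measurable lam" "g \<in> Mfun" "\<And>t. 0 \<le> t \<Longrightarrow> u t \<le> decr (modulus g) t"
  shows "W (embed u) \<le> W g"
proof (rule rearrangement_monoD)
  note [measurable] = modulus_measurable[OF assms(2)]
  have "decr u t \<le> decr (decr (modulus g)) t" for t
    using assms(3) by (intro decr_mono) (auto simp: space_lam)
  then show "decr (modulus (embed u)) t \<le> decr (modulus g) t" for t
    by (simp add: decr_decr)
qed (use assms in \<open>auto intro: rearrangement_mono_WL lattice_mono_L1 lattice_mono_Linf embed_in_Mfun\<close>)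

text \<open>Splitting at 1 costs no constant: each half of g* has its own integrable norm at most
  \<open>Xi g\<close>, and the two associate norms add up just as in \<open>WL\<close>.\<close>

lemma associate_WL_le:
  assumes f: "f \<in> Mfun"
  shows "associate Xi f \<le> WL (associate Ai) (associate Bi) f"
proof (rule associate_le)
  fix g assume g: "g \<in> Mfun" and fin: "Xi g < \<infinity>"
  let ?F = "decr (modulus f)" and ?G = "decr (modulus g)"
  let ?Fl = "\<lambda>t. ?F t * indicator {0..1} t" and ?Fr = "\<lambda>t. ?F t * indicator {1<..} t"
  let ?Gl = "\<lambda>t. ?G t * indicator {0..1} t" and ?Gr = "\<lambda>t. ?G t * indicator {1<..} t"
  note [measurable] = modulus_measurable[OF f] modulus_measurable[OF g]
  have G0: "embed ?Gl \<in> Mfun" and G1: "embed ?Gr \<in> Mfun"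
    by (auto intro!: embed_in_Mfun)
  have W: "W (embed ?Gl) \<le> W g" "W (embed ?Gr) \<le> W g"
    by (intro W_mono_decr g mult_indicator_le; measurable)+
  have "A (embed ?Gl) \<le> WL A B g" "B (embed ?Gr) \<le> WL A B g"
    by (simp_all add: WL_def rearrangement_eq_decr)
  then have le0: "Ai (embed ?Gl) \<le> Xi g" and le1: "Bi (embed ?Gr) \<le> Xi g"
    using W unfolding integrable_norm_def by (meson max.mono)+
  have "(\<integral>\<^sup>+x. modulus f x * modulus g x \<partial>lam) \<le> (\<integral>\<^sup>+t. ?F t * ?G t \<partial>lam)"
    by (rule hardy_littlewood) measurable
  also have "\<dots> = (\<integral>\<^sup>+t. ?Fl t * ?Gl t + ?Fr t * ?Gr t \<partial>lam)"
    by (intro nn_integral_cong) (auto simp: space_lam indicator_def)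
  also have "\<dots> = (\<integral>\<^sup>+t. ?Fl t * ?Gl t \<partial>lam) + (\<integral>\<^sup>+t. ?Fr t * ?Gr t \<partial>lam)"
    by (rule nn_integral_add) measurable
  also have "\<dots> \<le> associate Ai (embed ?Fl) * Ai (embed ?Gl) + associate Bi (embed ?Fr) * Bi (embed ?Gr)"
    using associate_hoelder[OF definite_integrable_norm G0, of A "embed ?Fl"]
      associate_hoelder[OF definite_integrable_norm G1, of B "embed ?Fr"] le0 le1 fin
    by (intro add_mono) (auto intro: order.strict_trans1)
  also have "\<dots> \<le> associate Ai (embed ?Fl) * Xi g + associate Bi (embed ?Fr) * Xi g"
    by (intro add_mono mult_left_mono le0 le1) auto
  also have "\<dots> = WL (associate Ai) (associate Bi) f * Xi g"
    by (simp add: WL_def rearrangement_eq_decr distrib_right)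
  finally show "(\<integral>\<^sup>+x. modulus f x * modulus g x \<partial>lam) \<le> \<dots>" .
qed

text \<open>The restriction to [0,1] is moved from f* to g*. The restricted g* is then an admissible
  test function for the amalgam, with norm at most \<open>Ai g\<close>.\<close>

lemma associate_inner_le:
  assumes f: "f \<in> Mfun"
  shows "associate Ai (embed (\<lambda>t. decr (modulus f) t * indicator {0..1} t)) \<le> associate Xi f"
proof (rule associate_le)
  fix g assume g: "g \<in> Mfun" and fin: "Ai g < \<infinity>"
  let ?F = "decr (modulus f)" and ?G = "decr (modulus g)"
  let ?Fl = "\<lambda>t. ?F t * indicator {0..1} t" and ?Gl = "\<lambda>t. ?G t * indicator {0..1} t"
  note [measurable] = modulus_measurable[OF f] modulus_measurable[OF g]
  have "decr ?Fl t \<le> ?F t" for t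
    using decr_mono[of ?F ?Fl t] by (simp add: decr_decr mult_indicator_le)
  moreover have "decr ?Fl t = 0" if "1 < t" for t
    by (rule decr_eq_0_of_support[of "{0..1}"])
       (use that in \<open>auto simp: space_lam emeasure_lam_interval not_le intro!: sets_lam_borel\<close>)
  ultimately have F0: "decr ?Fl t * ?G t \<le> ?F t * ?Gl t" if "0 \<le> t" for t
    using that by (cases "t \<le> 1") (auto intro!: mult_right_mono)
  have "WL A B (embed ?Gl) \<le> A (embed ?Gl)"
    by (intro WL_le_of_support A B) auto
  also have "\<dots> \<le> A (embed ?G)"
    by (intro lattice_monoD lattice_mono_norm A mult_indicator_le) measurable
  also have "\<dots> = A g" by (rule norm_decr[OF A g])
  finally have "WL A B (embed ?Gl) \<le> A g" .
  moreover have "W (embed ?Gl) \<le> W g"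
    by (intro W_mono_decr g mult_indicator_le) measurable
  ultimately have le: "Xi (embed ?Gl) \<le> Ai g"
    unfolding integrable_norm_def by (rule max.mono)
  have "(\<integral>\<^sup>+x. modulus (embed ?Fl) x * modulus g x \<partial>lam) \<le> (\<integral>\<^sup>+t. decr ?Fl t * ?G t \<partial>lam)"
    unfolding modulus_embed by (rule hardy_littlewood) measurable
  also have "\<dots> \<le> (\<integral>\<^sup>+t. ?F t * modulus (embed ?Gl) t \<partial>lam)"
    unfolding modulus_embed by (intro nn_integral_mono F0) (simp add: space_lam)
  also have "\<dots> \<le> associate Xi f * Xi (embed ?Gl)"
    using le fin
    by (intro associate_hoelder_decr definite_integrable_norm mono_Xi f embed_in_Mfun)
       (auto intro: order.strict_trans1)
  also have "\<dots> \<le> associate Xi f * Ai g" using le by (rule mult_left_mono) simp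
  finally show "(\<integral>\<^sup>+x. modulus (embed ?Fl) x * modulus g x \<partial>lam) \<le> \<dots>" .
qed

lemma Xi_unit_interval: "Xi (embed (indicator {0..1})) \<le> 1 + A (embed (indicator {0..1}))"
proof -
  have "WL A B (embed (indicator {0..1})) \<le> A (embed (indicator {0..1}))"
    by (intro WL_le_of_support A B) auto
  also have "\<dots> \<le> 1 + A (embed (indicator {0..1}))" by simp
  finally have "WL A B (embed (indicator {0..1})) \<le> 1 + A (embed (indicator {0..1}))" .
  moreover have "W (embed (indicator {0..1})) \<le> 1 + A (embed (indicator {0..1}))"
    using WL_L1_Linf_unit_interval by (rule order_trans) simp
  ultimately show ?thesis by (simp add: integrable_norm_def)
qed

text \<open>
  Flattening the rearrangement of \<open>g\<close> on \<open>{0..1}\<close> to its value at \<open>1\<close> turns a function of the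
  second component into one of the amalgam, since that value is at most the integral over \<open>{0..1}\<close>.
\<close>

lemma Xi_flattened_le:
  assumes g: "g \<in> Mfun" and fin: "Bi g < \<infinity>"
  shows "Xi (embed (\<lambda>t. min (decr (modulus g) t) (decr (modulus g) 1)))
    \<le> (1 + A (embed (indicator {0..1}))) * Bi g"
proof -
  let ?G = "decr (modulus g)" and ?a = "A (embed (indicator {0..1}))"
  let ?h = "\<lambda>t. min (?G t) (?G 1)"
  note [measurable] = modulus_measurable[OF g]
  have "?G 1 = (\<integral>\<^sup>+t. ?G 1 * indicator {0..1} t \<partial>lam)"
    by (subst nn_integral_cmult_indicator) (auto simp: emeasure_lam_interval intro!: sets_lam_borel)
  also have "\<dots> \<le> (\<integral>\<^sup>+t. ?G t * indicator {0..1} t \<partial>lam)"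
    by (intro nn_integral_mono) (auto simp: indicator_def intro: decr_antimono)
  also have "\<dots> \<le> W g" by (rule nn_integral_decr_le_WL[OF g])
  also have "\<dots> \<le> Bi g" by (simp add: integrable_norm_def)
  finally have G1: "?G 1 \<le> Bi g" .
  have hG: "decr ?h t \<le> ?G t" for t
    using decr_mono[of ?G ?h t] by (simp add: decr_decr)
  have h1: "decr ?h t \<le> ?G 1" for t
    by (rule decr_le_const) simp
  have "A (embed (\<lambda>t. decr ?h t * indicator {0..1} t)) \<le> A (embed (\<lambda>t. ?G 1 * indicator {0..1} t))"
    by (intro lattice_monoD lattice_mono_norm A) (auto intro!: mult_right_mono h1)
  \<comment> \<open>Homogeneity applies to finite scalars, and \<open>?G 1\<close> is finite because
    it is at most \<open>Bi g\<close>.\<close>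
  also have "\<dots> = ?G 1 * ?a"
    using G1 fin by (intro norm_scale A) (auto intro: order.strict_trans1)
  also have "\<dots> \<le> ?a * Bi g"
    using G1 by (subst mult.commute) (rule mult_left_mono, auto)
  finally have hA: "A (embed (\<lambda>t. decr ?h t * indicator {0..1} t)) \<le> ?a * Bi g" .
  have "B (embed (\<lambda>t. decr ?h t * indicator {1<..} t)) \<le> B (embed ?G)"
    by (intro lattice_monoD lattice_mono_norm B order_trans[OF mult_indicator_le hG]) measurable
  also have "\<dots> = B g" by (rule norm_decr[OF B g])
  also have "\<dots> \<le> Bi g" by (simp add: integrable_norm_def)
  finally have "WL A B (embed ?h) \<le> ?a * Bi g + Bi g"
    unfolding WL_embed by (rule add_mono[OF hA])
  moreover have "W (embed ?h) \<le> Bi g"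
  proof -
    have "W (embed ?h) \<le> W g" by (intro W_mono_decr g) auto
    also have "\<dots> \<le> Bi g" by (simp add: integrable_norm_def)
    finally show ?thesis .
  qed
  then have "W (embed ?h) \<le> ?a * Bi g + Bi g" by (rule order_trans) simp
  ultimately have "Xi (embed ?h) \<le> ?a * Bi g + Bi g" by (simp add: integrable_norm_def)
  then show ?thesis by (simp add: distrib_right add.commute)
qed

text \<open>Rearranging the outer part of f* shifts it to the origin, where it meets the large
  values of g*. There it is at most f*(1), and beyond 1 it is at most f*. The two resulting terms
  each contribute the factor \<open>1 + A (embed (indicator {0..1}))\<close>, whence the 2.\<close>

lemma associate_outer_le:
  assumes f: "f \<in> Mfun"
  shows "associate Bi (embed (\<lambda>t. decr (modulus f) t * indicator {1<..} t))
    \<le> (2 * (1 + A (embed (indicator {0..1})))) * associate Xi f"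
proof (rule associate_le)
  fix g assume g: "g \<in> Mfun" and fin: "Bi g < \<infinity>"
  let ?F = "decr (modulus f)" and ?G = "decr (modulus g)" and ?a = "A (embed (indicator {0..1}))"
  let ?Fr = "\<lambda>t. ?F t * indicator {1<..} t" and ?h = "\<lambda>t. min (?G t) (?G 1)"
  let ?S = "associate Xi f"
  note [measurable] = modulus_measurable[OF f] modulus_measurable[OF g]
  have a: "1 + ?a < \<infinity>" using norm_unit_interval[OF A] by (simp add: less_top)
  have double: "S * e * b + S * (e * b) = (2 * e) * S * b" for S e b :: ennreal
    by (simp add: mult_2[symmetric] ac_simps)
  have FF: "decr ?Fr t \<le> ?F t" for t
    using decr_mono[of ?F ?Fr t] by (simp add: decr_decr mult_indicator_le)
  have F1: "decr ?Fr t \<le> ?F 1" for t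
    by (rule decr_le_const) (auto simp: indicator_def intro: decr_antimono)
  have pointwise: "decr ?Fr t * ?G t \<le> ?F 1 * (?G t * indicator {0..1} t) + ?F t * ?h t"
    if "0 \<le> t" for t
  proof (cases "t \<le> 1")
    case True
    then have "decr ?Fr t * ?G t \<le> ?F 1 * (?G t * indicator {0..1} t)"
      using F1 that by (auto intro!: mult_right_mono)
    then show ?thesis by (rule order_trans) simp
  next
    case False
    then have "?h t = ?G t" by (auto simp: min_def intro: decr_antimono)
    then show ?thesis using FF[of t] by (auto intro!: mult_right_mono order_trans[OF _ add_increasing])
  qed
  \<comment> \<open>f*(1) is at most the integral of f* over [0,1], which is the pairing of f* with
    the test function \<open>indicator {0..1}\<close>.\<close>
  have "?F 1 = (\<integral>\<^sup>+t. ?F 1 * indicator {0..1} t \<partial>lam)"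
    by (subst nn_integral_cmult_indicator) (auto simp: emeasure_lam_interval intro!: sets_lam_borel)
  also have "\<dots> \<le> (\<integral>\<^sup>+t. ?F t * modulus (embed (indicator {0..1})) t \<partial>lam)"
    by (intro nn_integral_mono) (auto simp: indicator_def intro: decr_antimono)
  also have "\<dots> \<le> ?S * Xi (embed (indicator {0..1}))"
    using Xi_unit_interval a
    by (intro associate_hoelder_decr definite_integrable_norm mono_Xi f embed_in_Mfun)
       (auto intro: order.strict_trans1)
  also have "\<dots> \<le> ?S * (1 + ?a)" by (intro mult_left_mono Xi_unit_interval) simp
  finally have F_at_1: "?F 1 \<le> ?S * (1 + ?a)" .
  have "(\<integral>\<^sup>+t. ?G t * indicator {0..1} t \<partial>lam) \<le> W g" by (rule nn_integral_decr_le_WL[OF g])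
  also have "\<dots> \<le> Bi g" by (simp add: integrable_norm_def)
  finally have G_int: "(\<integral>\<^sup>+t. ?G t * indicator {0..1} t \<partial>lam) \<le> Bi g" .
  have h: "embed ?h \<in> Mfun" by (intro embed_in_Mfun) measurable
  have "(1 + ?a) * Bi g < \<infinity>" using a fin by (simp add: ennreal_mult_less_top)
  then have "Xi (embed ?h) < \<infinity>"
    using Xi_flattened_le[OF g fin] by (rule order.strict_trans1[rotated])
  then have "(\<integral>\<^sup>+t. ?F t * modulus (embed ?h) t \<partial>lam) \<le> ?S * Xi (embed ?h)"
    by (intro associate_hoelder_decr definite_integrable_norm mono_Xi f h)
  also have "\<dots> \<le> ?S * ((1 + ?a) * Bi g)"
    by (intro mult_left_mono Xi_flattened_le g fin) simp
  finally have Fh: "(\<integral>\<^sup>+t. ?F t * ?h t \<partial>lam) \<le> ?S * ((1 + ?a) * Bi g)" by simp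
  have "(\<integral>\<^sup>+x. modulus (embed ?Fr) x * modulus g x \<partial>lam) \<le> (\<integral>\<^sup>+t. decr ?Fr t * ?G t \<partial>lam)"
    unfolding modulus_embed by (rule hardy_littlewood) measurable
  also have "\<dots> \<le> (\<integral>\<^sup>+t. ?F 1 * (?G t * indicator {0..1} t) + ?F t * ?h t \<partial>lam)"
    by (intro nn_integral_mono pointwise) (simp add: space_lam)
  also have "\<dots> = ?F 1 * (\<integral>\<^sup>+t. ?G t * indicator {0..1} t \<partial>lam) + (\<integral>\<^sup>+t. ?F t * ?h t \<partial>lam)"
    by (subst nn_integral_add) (auto simp: nn_integral_cmult)
  also have "\<dots> \<le> (?S * (1 + ?a)) * Bi g + ?S * ((1 + ?a) * Bi g)"
    by (intro add_mono mult_mono F_at_1 G_int Fh) auto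
  also have "\<dots> = (2 * (1 + ?a)) * ?S * Bi g"
    by (rule double)
  finally show "(\<integral>\<^sup>+x. modulus (embed ?Fr) x * modulus g x \<partial>lam) \<le> \<dots>" .
qed

lemma WL_associate_le:
  assumes f: "f \<in> Mfun"
  shows "WL (associate Ai) (associate Bi) f
    \<le> (1 + 2 * (1 + A (embed (indicator {0..1})))) * associate Xi f"
proof -
  have "WL (associate Ai) (associate Bi) f
      \<le> associate Xi f + (2 * (1 + A (embed (indicator {0..1})))) * associate Xi f"
    unfolding WL_def[of "associate Ai" "associate Bi"] rearrangement_eq_decr
    by (intro add_mono associate_inner_le associate_outer_le f)
  then show ?thesis by (simp only: distrib_right mult_1)
qed

end

theorem theorem5p4:
  fixes A B :: functional
  assumes "ri_quasi_banach_function_norm A"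
    and "ri_quasi_banach_function_norm B"
  shows "(\<exists>C::real. 0 < C \<and>
            (\<forall>f\<in>Mfun.
               integrable_associate (WL A B) f
                 \<le> WL (integrable_associate A) (integrable_associate B) f \<and>
               WL (integrable_associate A) (integrable_associate B) f
                 \<le> ennreal C * integrable_associate (WL A B) f))
         \<and> fspace (integrable_associate (WL A B))
             = fspace (WL (integrable_associate A) (integrable_associate B))"
proof -
  \<comment> \<open>The inner estimate contributes 1 and the outer one the rest. Finiteness is (P4)
    for \<open>A\<close> on [0,1].\<close>
  let ?c = "1 + 2 * (1 + A (embed (indicator {0..1})))"
  have "?c < \<infinity>"
    using norm_unit_interval[OF assms(1)] by (simp add: ennreal_mult_less_top less_top)
  then obtain C where C: "?c = ennreal C" by (cases ?c) auto
  have "0 < ?c" by (rule order.strict_trans2[OF zero_less_one]) simp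
  then have "0 < C" unfolding C by simp
  have le: "integrable_associate (WL A B) f \<le> WL (integrable_associate A) (integrable_associate B) f"
    if "f \<in> Mfun" for f
    using associate_WL_le[OF assms that] unfolding integrable_associate_def .
  have ge: "WL (integrable_associate A) (integrable_associate B) f \<le> ennreal C * integrable_associate (WL A B) f"
    if "f \<in> Mfun" for f
    using WL_associate_le[OF assms that] unfolding integrable_associate_def C .
  have "integrable_associate (WL A B) f < \<infinity> \<longleftrightarrow> WL (integrable_associate A) (integrable_associate B) f < \<infinity>"
    if "f \<in> Mfun" for f
  proof
    assume "integrable_associate (WL A B) f < \<infinity>"
    then have "ennreal C * integrable_associate (WL A B) f < \<infinity>" by (simp add: ennreal_mult_less_top)
    then show "WL (integrable_associate A) (integrable_associate B) f < \<infinity>"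
      using ge[OF that] by (rule order.strict_trans1[rotated])
  qed (use le[OF that] in \<open>rule order.strict_trans1\<close>)
  then have "fspace (integrable_associate (WL A B)) = fspace (WL (integrable_associate A) (integrable_associate B))"
    unfolding fspace_def by blast
  with \<open>0 < C\<close> le ge show ?thesis by blast
qed

end
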